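(* Let $D_0$ be a northeast diagram. Then the Kohnert poset $\mathcal{P}(D_0)$ is bounded (equivalently, has a unique minimal element) if and only if $D_0$ does not contain cells $x_1=(r_1,c_1)$, $x_2=(r_2,c_2)$, $x_3=(r_3,c_3)$ such that: (a) $r_1\le r_2<r_3$; (b) $c_1<c_2=c_3$; (c) for each column $c$ with $c_1\le c<c_2$, $\mathrm{cwt}(D_0)_c<\mathrm{cwt}(D_0)_{c_2}$; (d) for each column $c\ge c_1$, there is at least one empty position $(r,c)$ (i.e. $(r,c)\notin D_0$) with $r<r_1$; and (e) for each $r$ with $r_1<r\le r_3$, the cell $(r,c_1)$ is not in $D_0$.
   Context: A diagram is a finite subset of $\mathbb{N}\times\mathbb{N}$ ($\mathbb{N}=\{1,2,\dots\}$); an element $(r,c)$ is a cell in row $r$ and column $c$, rows numbered bottom to top; a position is empty if not in the diagram. $\mathrm{cwt}(D)_c$ denotes the number of cells of $D$ in column $c$. A Kohnert move on $D$ selects a row, takes the rightmost cell $(r,c)$ of $D$ in that row, and moves it to $(r',c)$ where $r'$ is the largest $1\le r'<r$ with $(r',c)\notin D$ (no move if none exists). The Kohnert poset $\mathcal{P}(D)$ is the set of diagrams obtainable from $D$ by finitely many Kohnert moves (including $D$), ordered by the transitive closure of $D_2<D_1$ whenever $D_2$ results from $D_1$ by one Kohnert move; $D$ is its unique maximal element. A diagram $D$ is northeast if for all cells $(r_1,c_1),(r_2,c_2)\in D$, $(\max(r_1,r_2),\max(c_1,c_2))\in D$. *)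

theory Defs
  imports "HOL-Algebra.Order"
begin

text \<open>A cell is a pair (row, column) of positive integers; positivity is imposed by
  \<open>is_diagram\<close>, since the type \<^typ>\<open>nat\<close> contains 0.\<close>

type_synonym diagram = "(nat \<times> nat) set"

definition is_diagram :: "diagram \<Rightarrow> bool" where
  "is_diagram D \<longleftrightarrow> finite D \<and> D \<subseteq> {1..} \<times> {1..}"

definition cwt :: "diagram \<Rightarrow> nat \<Rightarrow> nat" where
  "cwt D c = card {r. (r, c) \<in> D}"

definition northeast :: "diagram \<Rightarrow> bool" where
  "northeast D \<longleftrightarrow>
     (\<forall>r1 c1 r2 c2. (r1, c1) \<in> D \<and> (r2, c2) \<in> D \<longrightarrow> (max r1 r2, max c1 c2) \<in> D)"

text \<open>Row 1 is the bottom row. A selected row whose rightmost cell cannot drop gives no move,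
  so the relation is irreflexive.\<close>

definition kohnert_move :: "diagram \<Rightarrow> diagram \<Rightarrow> bool" where
  "kohnert_move D E \<longleftrightarrow>
     (\<exists>r c r'. (r, c) \<in> D \<and> (\<forall>c'. (r, c') \<in> D \<longrightarrow> c' \<le> c)
        \<and> 1 \<le> r' \<and> r' < r \<and> (r', c) \<notin> D
        \<and> (\<forall>s. 1 \<le> s \<and> s < r \<and> (s, c) \<notin> D \<longrightarrow> s \<le> r')
        \<and> E = insert (r', c) (D - {(r, c)}))"

text \<open>Every diagram on a chain of moves starting in the carrier again lies in the carrier, so the
  order need not be restricted to it.\<close>

definition kohnert_poset :: "diagram \<Rightarrow> diagram gorder" where
  "kohnert_poset D =
     \<lparr>carrier = {E. kohnert_move\<^sup>*\<^sup>* D E}, eq = (=), le = (\<lambda>A B. kohnert_move\<^sup>*\<^sup>* B A)\<rparr>"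

definition bounded_poset :: "('a, 'b) gorder_scheme \<Rightarrow> bool" where
  "bounded_poset L \<longleftrightarrow> partial_order L
     \<and> (\<exists>b. least L b (carrier L)) \<and> (\<exists>t. greatest L t (carrier L))"

definition minimal_element :: "('a, 'b) gorder_scheme \<Rightarrow> 'a \<Rightarrow> bool" where
  "minimal_element L m \<longleftrightarrow> m \<in> carrier L \<and> \<not> (\<exists>x \<in> carrier L. x \<sqsubset>\<^bsub>L\<^esub> m)"

end

theory Submission
  imports Defs
begin

text \<open>
  A diagram is minimal iff the rightmost cell of every row has no gap below it. Hence, if A is the
  top row of the cells of a minimal diagram right of column c, some column right of c is filled
  exactly up to row A, and every cell of column c in rows up to A is blocked.

  Without the obstruction, two minimal diagrams that agree right of c agree in column c as well.
  If column c has at least A cells, it must be bottom-justified. Otherwise write k for its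
  number of cells and S for the original column: a minimal diagram has exactly
  \<open>max \<bar>S \<inter> [1,t]\<bar> (k + t - A)\<close> cells of column c in rows up to t. The lower bound is a count. The
  upper bound comes from a column c2 with A cells: by the northeast condition and the absence of
  the obstruction, the cells of column c above a permanently frozen part are matched with the top
  cells of c2 in the same rows, and a cell can never pass its partner.

  Given the obstruction, pushing all columns right of c1 down first freezes column c1 in rows up
  to some A, whereas pushing down first only the cells in rows up to r1 and columns from c1 on
  brings more cells of column c1 into some initial segment of rows than the frozen column can ever
  have there.
\<close>

section \<open>Column counts, restricted moves and blocked diagrams\<close>

text \<open>Cumulative counts determine a column and can only grow under moves, so comparing columns
  becomes arithmetic.\<close>

definition cnt :: "diagram \<Rightarrow> nat \<Rightarrow> nat \<Rightarrow> nat" where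
  "cnt D c t = card {r. r \<le> t \<and> (r, c) \<in> D}"

definition cell_drop :: "diagram \<Rightarrow> nat \<Rightarrow> nat \<Rightarrow> nat \<Rightarrow> bool" where
  "cell_drop D r c r' \<longleftrightarrow> (r, c) \<in> D \<and> (\<forall>c'. (r, c') \<in> D \<longrightarrow> c' \<le> c)
     \<and> 1 \<le> r' \<and> r' < r \<and> (r', c) \<notin> D \<and> (\<forall>s. r' < s \<and> s < r \<longrightarrow> (s, c) \<in> D)"

text \<open>Only the starting position is restricted to \<open>R\<close>; the cell must still be
  rightmost in its whole row, so each such move is a Kohnert move.\<close>

definition region_move :: "(nat \<times> nat) set \<Rightarrow> diagram \<Rightarrow> diagram \<Rightarrow> bool" where
  "region_move R D E \<longleftrightarrow>
     (\<exists>r c r'. (r, c) \<in> R \<and> cell_drop D r c r' \<and> E = insert (r', c) (D - {(r, c)}))"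

text \<open>For \<open>R = X \<times> {a..}\<close> this says that no move starts in
  \<open>R\<close>: the rightmost cell of a row meeting \<open>R\<close> then lies in
  \<open>R\<close> and can only be blocked by its own column. Quantifying over all cells provides a
  blocking column for any cell at hand.\<close>

definition stuck :: "(nat \<times> nat) set \<Rightarrow> diagram \<Rightarrow> bool" where
  "stuck R D \<longleftrightarrow> (\<forall>r c. (r, c) \<in> D \<inter> R \<longrightarrow> (\<exists>c'\<ge>c. \<forall>s\<in>{1..r}. (s, c') \<in> D))"

definition obstruction :: "diagram \<Rightarrow> nat \<Rightarrow> nat \<Rightarrow> nat \<Rightarrow> nat \<Rightarrow> nat \<Rightarrow> bool" where
  "obstruction D r1 c1 r2 r3 c2 \<longleftrightarrow>
     (r1, c1) \<in> D \<and> (r2, c2) \<in> D \<and> (r3, c2) \<in> D \<and> r1 \<le> r2 \<and> r2 < r3 \<and> c1 < c2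
     \<and> (\<forall>c. c1 \<le> c \<and> c < c2 \<longrightarrow> cwt D c < cwt D c2)
     \<and> (\<forall>c. c1 \<le> c \<longrightarrow> (\<exists>r. 1 \<le> r \<and> r < r1 \<and> (r, c) \<notin> D))
     \<and> (\<forall>r. r1 < r \<and> r \<le> r3 \<longrightarrow> (r, c1) \<notin> D)"

section \<open>Restricted moves and their termination\<close>

lemma kohnert_move_eq: "kohnert_move = region_move UNIV"
proof -
  have "((r, c) \<in> D \<and> (\<forall>c'. (r, c') \<in> D \<longrightarrow> c' \<le> c) \<and> 1 \<le> r' \<and> r' < r \<and> (r', c) \<notin> D
      \<and> (\<forall>s. 1 \<le> s \<and> s < r \<and> (s, c) \<notin> D \<longrightarrow> s \<le> r')) \<longleftrightarrow> cell_drop D r c r'" for D r c r'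
  proof (cases "1 \<le> r'")
    case True
    have *: "(\<forall>s. 1 \<le> s \<and> s < r \<and> (s, c) \<notin> D \<longrightarrow> s \<le> r') \<longleftrightarrow> (\<forall>s. r' < s \<and> s < r \<longrightarrow> (s, c) \<in> D)"
      using True by (meson linorder_not_less nat_less_le order_le_less_trans)
    show ?thesis unfolding * cell_drop_def by (rule refl)
  qed (simp add: cell_drop_def)
  then have "kohnert_move D E \<longleftrightarrow> region_move UNIV D E" for D E
    unfolding kohnert_move_def region_move_def by (simp only: UNIV_I simp_thms conj_assoc[symmetric])
  then show ?thesis by blast
qed

lemma region_move_kohnert:
  assumes "(region_move R)\<^sup>*\<^sup>* D E" shows "kohnert_move\<^sup>*\<^sup>* D E"
proof -
  have "region_move R \<le> kohnert_move"
    unfolding kohnert_move_eq region_move_def by blast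
  from rtranclp_mono[OF this] assms show ?thesis by blast
qed

lemma stuck_subset: "stuck R D \<Longrightarrow> R' \<subseteq> R \<Longrightarrow> stuck R' D"
  unfolding stuck_def by blast

lemma is_diagram_move: "is_diagram D \<Longrightarrow> region_move R D E \<Longrightarrow> is_diagram E"
  unfolding is_diagram_def region_move_def cell_drop_def by auto

lemma is_diagram_moves: "kohnert_move\<^sup>*\<^sup>* D E \<Longrightarrow> is_diagram D \<Longrightarrow> is_diagram E"
  by (induction rule: rtranclp_induct) (auto simp: kohnert_move_eq dest: is_diagram_move)

text \<open>The sum of the row indices is the termination measure, and it later yields antisymmetry
  of the order.\<close>

lemma sum_rows_move:
  assumes "finite D" "region_move R D E"
  shows "sum fst E < sum fst D"
proof -
  obtain r c r' where m: "cell_drop D r c r'" "E = insert (r', c) (D - {(r, c)})"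
    using assms(2) unfolding region_move_def by blast
  then have "sum fst E = r' + sum fst (D - {(r, c)})"
    using assms(1) by (simp add: cell_drop_def)
  moreover have "sum fst D = r + sum fst (D - {(r, c)})"
    using sum.remove[of D "(r, c)" fst] m assms(1) by (simp add: cell_drop_def)
  ultimately show ?thesis using m by (simp add: cell_drop_def)
qed

lemma sum_rows_moves:
  assumes "kohnert_move\<^sup>*\<^sup>* D E" "is_diagram D"
  shows "E = D \<or> sum fst E < sum fst D"
  using assms
proof (induction rule: rtranclp_induct)
  case (step E F)
  then have "sum fst F < sum fst E"
    using sum_rows_move is_diagram_moves kohnert_move_eq is_diagram_def by metis
  with step show ?case by auto
qed simp

text \<open>The region is closed to the right within a row, so the rightmost cell in the row of a
  violating cell lies in it too and has a gap below.\<close>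

lemma move_if_not_stuck:
  assumes "finite D" "\<not> stuck R D" "R = X \<times> {a..}"
  shows "\<exists>E. region_move R D E"
proof -
  obtain r c where rc: "(r, c) \<in> D" "(r, c) \<in> R" "\<And>c'. c' \<ge> c \<Longrightarrow> \<exists>s\<in>{1..r}. (s, c') \<notin> D"
    using assms(2) unfolding stuck_def by blast
  define C where "C = {c'. (r, c') \<in> D}"
  have "C \<subseteq> snd ` D" unfolding C_def by force
  then have finC: "finite C" using assms(1) finite_surj by blast
  define m where "m = Max C"
  have m: "(r, m) \<in> D" "c \<le> m" "\<And>c'. (r, c') \<in> D \<Longrightarrow> c' \<le> m"
    using Max_in[OF finC] Max_ge[OF finC] rc(1) unfolding C_def m_def by auto
  define G where "G = {s. 1 \<le> s \<and> s < r \<and> (s, m) \<notin> D}"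
  have finG: "finite G" by (rule finite_subset[of _ "{..<r}"]) (auto simp: G_def)
  obtain s where "s \<in> {1..r}" "(s, m) \<notin> D" using rc(3)[OF m(2)] by blast
  then have "s \<in> G" unfolding G_def using m(1) by (auto simp: le_less)
  then have G: "Max G \<in> G" using Max_in[OF finG] by blast
  have "(s, m) \<in> D" if "Max G < s" "s < r" for s
  proof (rule ccontr)
    assume "(s, m) \<notin> D"
    then have "s \<in> G" using that unfolding G_def by auto
    then show False using Max_ge[OF finG] that by fastforce
  qed
  moreover have "1 \<le> Max G \<and> Max G < r \<and> (Max G, m) \<notin> D" using G unfolding G_def mem_Collect_eq .
  ultimately have "cell_drop D r m (Max G)" using m unfolding cell_drop_def by blast
  moreover have "(r, m) \<in> R" using rc(2) m(2) assms(3) by auto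
  ultimately show ?thesis unfolding region_move_def by blast
qed

lemma stuck_no_move:
  assumes "stuck UNIV D" shows "\<not> kohnert_move D E"
proof
  assume "kohnert_move D E"
  then obtain r c r' where m: "cell_drop D r c r'" unfolding kohnert_move_eq region_move_def by blast
  then have "(r, c) \<in> D" by (simp add: cell_drop_def)
  then obtain c' where "c' \<ge> c" "\<forall>s\<in>{1..r}. (s, c') \<in> D" using assms unfolding stuck_def by blast
  moreover from this m have "(r, c') \<in> D" "c' \<le> c" by (auto simp: cell_drop_def)
  ultimately show False using m by (auto simp: cell_drop_def)
qed

lemma reach_stuck:
  assumes "is_diagram D" "R = X \<times> {a..}"
  shows "\<exists>E. (region_move R)\<^sup>*\<^sup>* D E \<and> stuck R E"
  using assms(1)
proof (induction "sum fst D" arbitrary: D rule: less_induct)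
  case less
  show ?case
  proof (cases "stuck R D")
    case False
    then obtain E where E: "region_move R D E"
      using move_if_not_stuck assms(2) less.prems is_diagram_def by metis
    then have "sum fst E < sum fst D" "is_diagram E"
      using sum_rows_move is_diagram_move less.prems is_diagram_def by metis+
    then obtain F where "(region_move R)\<^sup>*\<^sup>* E F" "stuck R F" using less.hyps by blast
    then show ?thesis using E by (meson converse_rtranclp_into_rtranclp)
  qed auto
qed

lemma reach_stuck_UNIV:
  assumes "is_diagram D"
  shows "\<exists>E. kohnert_move\<^sup>*\<^sup>* D E \<and> stuck UNIV E"
  using reach_stuck[OF assms, of UNIV UNIV 0] by (auto simp: kohnert_move_eq)

section \<open>Arithmetic of column counts\<close>

lemma cnt_split:
  assumes "t \<le> u"
  shows "cnt D c u = cnt D c t + card {r. t < r \<and> r \<le> u \<and> (r, c) \<in> D}"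
proof -
  have "{r. r \<le> u \<and> (r, c) \<in> D} = {r. r \<le> t \<and> (r, c) \<in> D} \<union> {r. t < r \<and> r \<le> u \<and> (r, c) \<in> D}"
    using assms by auto
  moreover have "{r. r \<le> t \<and> (r, c) \<in> D} \<inter> {r. t < r \<and> r \<le> u \<and> (r, c) \<in> D} = {}" by auto
  moreover have "finite {r. t < r \<and> r \<le> u \<and> (r, c) \<in> D}" by (rule finite_subset[of _ "{..u}"]) auto
  ultimately show ?thesis unfolding cnt_def by (simp add: card_Un_disjoint)
qed

lemma cnt_mono: "t \<le> u \<Longrightarrow> cnt D c t \<le> cnt D c u"
  by (simp add: cnt_split)

lemma cnt_le_add:
  assumes "t \<le> u" shows "cnt D c u \<le> cnt D c t + (u - t)"
proof -
  have "card {r. t < r \<and> r \<le> u \<and> (r, c) \<in> D} \<le> card {t<..u}"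
    by (rule card_mono) auto
  then show ?thesis using cnt_split[OF assms, of D c] by simp
qed

lemma cnt_filled:
  assumes "t \<le> u" "\<And>r. t < r \<Longrightarrow> r \<le> u \<Longrightarrow> (r, c) \<in> D"
  shows "cnt D c u = cnt D c t + (u - t)"
proof -
  have "{r. t < r \<and> r \<le> u \<and> (r, c) \<in> D} = {t<..u}" using assms by auto
  then show ?thesis using cnt_split[OF assms(1), of D c] by simp
qed

lemma cnt_zero: "is_diagram D \<Longrightarrow> cnt D c 0 = 0"
  unfolding cnt_def is_diagram_def by (auto simp: card_eq_0_iff)

lemma cnt_le: "is_diagram D \<Longrightarrow> cnt D c t \<le> t"
  using cnt_le_add[of 0 t D c] cnt_zero by simp

lemma cnt_initial:
  assumes "is_diagram D" "\<And>s. s \<in> {1..t} \<Longrightarrow> (s, c) \<in> D"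
  shows "cnt D c t = t"
  using cnt_filled[of 0 t c D] assms cnt_zero[OF assms(1)] by auto

lemma cnt_no_above:
  assumes "t \<le> u" "\<And>r. (r, c) \<in> D \<Longrightarrow> r \<le> u \<Longrightarrow> r \<le> t"
  shows "cnt D c u = cnt D c t"
proof -
  have "{r. r \<le> u \<and> (r, c) \<in> D} = {r. r \<le> t \<and> (r, c) \<in> D}" using assms by fastforce
  then show ?thesis by (simp add: cnt_def)
qed

lemma cnt_less:
  assumes "t < u" "(u, c) \<in> D" shows "cnt D c t < cnt D c u"
proof -
  have "{r. r \<le> t \<and> (r, c) \<in> D} \<subset> {r. r \<le> u \<and> (r, c) \<in> D}" 
  proof
    have "u \<in> {r. r \<le> u \<and> (r, c) \<in> D} - {r. r \<le> t \<and> (r, c) \<in> D}" using assms by simp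
    then show "{r. r \<le> t \<and> (r, c) \<in> D} \<noteq> {r. r \<le> u \<and> (r, c) \<in> D}" by blast
  qed (use assms in auto)
  then show ?thesis unfolding cnt_def by (simp add: psubset_card_mono)
qed

lemma cnt_full:
  assumes "is_diagram D" "cnt D c t = t" "s \<in> {1..t}"
  shows "(s, c) \<in> D"
proof (rule ccontr)
  assume "(s, c) \<notin> D"
  then have "{r. r \<le> t \<and> (r, c) \<in> D} \<subseteq> {1..t} - {s}"
    using assms(1) unfolding is_diagram_def by auto
  then have "cnt D c t \<le> card ({1..t} - {s})" unfolding cnt_def by (intro card_mono) auto
  then show False using assms(2,3) by auto
qed

text \<open>A row is occupied exactly where the cumulative count jumps; row 0, which has no
  predecessor, is always empty.\<close>

lemma cnt_eq_column:
  assumes "is_diagram D" "is_diagram E" "\<And>t. cnt D c t = cnt E c t"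
  shows "(r, c) \<in> D \<longleftrightarrow> (r, c) \<in> E"
proof -
  have *: "(r, c) \<in> F \<longleftrightarrow> r \<noteq> 0 \<and> cnt F c (r - 1) < cnt F c r" if "is_diagram F" for F
  proof -
    have "(r, c) \<in> F \<longrightarrow> r \<noteq> 0" using that unfolding is_diagram_def by auto
    moreover have "cnt F c r = cnt F c (r - 1)" if "(r, c) \<notin> F"
    proof (rule cnt_no_above)
      fix s assume "(s, c) \<in> F" "s \<le> r"
      then have "s \<noteq> r" using that by auto
      then show "s \<le> r - 1" using \<open>s \<le> r\<close> by auto
    qed simp
    ultimately show ?thesis using cnt_less[of "r - 1" r c F] by fastforce
  qed
  show ?thesis using *[OF assms(1)] *[OF assms(2)] assms(3) by simp
qed

section \<open>Column counts under moves\<close>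

text \<open>Thresholds from \<open>r'\<close> up to but excluding \<open>r\<close> see the cell only
  after its fall; all others see it both before and after, or never.\<close>

lemma cnt_move:
  assumes "cell_drop D r c r'"
  shows "cnt (insert (r', c) (D - {(r, c)})) c' t
    = cnt D c' t + (if c' = c \<and> r' \<le> t \<and> t < r then 1 else 0)"
proof (cases "c' = c")
  case False
  then have "{s. s \<le> t \<and> (s, c') \<in> insert (r', c) (D - {(r, c)})} = {s. s \<le> t \<and> (s, c') \<in> D}"
    by auto
  then show ?thesis using False by (simp add: cnt_def)
next
  case True
  define S where "S = {s. s \<le> t \<and> (s, c) \<in> D}"
  have fin: "finite S" unfolding S_def by simp
  have r': "r' \<notin> S" "r' < r" and r: "r \<in> S \<longleftrightarrow> r \<le> t"
    using assms unfolding S_def cell_drop_def by auto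
  have "{s. s \<le> t \<and> (s, c) \<in> insert (r', c) (D - {(r, c)})}
      = (if r' \<le> t then insert r' (S - {r}) else S - {r})"
    unfolding S_def using assms by (auto simp: cell_drop_def)
  moreover have "card (if r' \<le> t then insert r' (S - {r}) else S - {r})
      = card S + (if r' \<le> t \<and> t < r then 1 else 0)"
    using fin r r' card_Suc_Diff1[OF fin, of r] by auto
  ultimately show ?thesis using True by (simp add: cnt_def S_def)
qed

lemma cnt_moves_mono: "kohnert_move\<^sup>*\<^sup>* D E \<Longrightarrow> cnt D c t \<le> cnt E c t"
  by (induction rule: rtranclp_induct)
    (auto simp: kohnert_move_eq region_move_def cnt_move)

text \<open>Every moving cell starts at or below row \<open>b\<close>, so the threshold
  \<open>b\<close> sees it before and after.\<close>

lemma cnt_moves_rows: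
  assumes "(region_move ({..b} \<times> Y))\<^sup>*\<^sup>* D E" shows "cnt E c b = cnt D c b"
  using assms by (induction rule: rtranclp_induct) (auto simp: region_move_def cnt_move)

text \<open>With \<open>B\<close> bounding all rows, the count up to \<open>B\<close> is the weight
  of the column, so its invariance is the conservation of column weights.\<close>

lemma moves_rows_bounded:
  assumes "kohnert_move\<^sup>*\<^sup>* D E" "\<forall>r c. (r, c) \<in> D \<longrightarrow> r \<le> B"
  shows "(\<forall>r c. (r, c) \<in> E \<longrightarrow> r \<le> B) \<and> cnt E c B = cnt D c B"
  using assms(1)
proof (induction rule: rtranclp_induct)
  case (step E F)
  then obtain r c0 r' where m: "cell_drop E r c0 r'" "F = insert (r', c0) (E - {(r, c0)})"
    unfolding kohnert_move_eq region_move_def by blast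
  then have "r \<le> B" "r' \<le> B" using step.IH by (auto simp: cell_drop_def intro: less_imp_le less_le_trans)
  then show ?case using m step.IH by (auto simp: cnt_move)
qed (use assms(2) in auto)

lemma columns_unmoved:
  assumes "(region_move (UNIV \<times> {a..}))\<^sup>*\<^sup>* D E" "c < a"
  shows "(r, c) \<in> E \<longleftrightarrow> (r, c) \<in> D"
  using assms(1)
proof (induction rule: rtranclp_induct)
  case (step E F)
  then show ?case using assms(2) by (fastforce simp: region_move_def)
qed simp

lemma cnt_cwt:
  assumes "\<forall>r c. (r, c) \<in> D \<longrightarrow> r \<le> B" shows "cnt D c B = cwt D c"
  unfolding cnt_def cwt_def using assms by (auto intro: arg_cong[of _ _ card])

section \<open>Blocking columns and frozen rows\<close>

text \<open>The column blocking a cell in the top occupied row of the region is filled exactly that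
  far. Writing this row as a count up to \<open>b\<close> allows comparison with the original
  diagram.\<close>

lemma stuck_top_row:
  assumes "is_diagram E" "stuck ({..b} \<times> {a..}) E" "(r0, c0) \<in> E" "r0 \<le> b" "a \<le> c0"
  obtains c where "a \<le> c" "\<forall>s\<in>{1..cnt E c b}. (s, c) \<in> E"
    "\<forall>r c'. (r, c') \<in> E \<and> r \<le> b \<and> a \<le> c' \<longrightarrow> r \<le> cnt E c b"
proof -
  define T where "T = {r. r \<le> b \<and> (\<exists>c'\<ge>a. (r, c') \<in> E)}"
  have fin: "finite T" and ne: "T \<noteq> {}" unfolding T_def using assms by auto
  then have "Max T \<in> T" by simp
  then obtain c' where c': "Max T \<le> b" "a \<le> c'" "(Max T, c') \<in> E" unfolding T_def by auto
  then obtain c where c: "c \<ge> c'" "\<forall>s\<in>{1..Max T}. (s, c) \<in> E"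
    using assms(2) unfolding stuck_def by fastforce
  have up: "r \<le> Max T" if "(r, c'') \<in> E" "r \<le> b" "a \<le> c''" for r c''
    using that fin unfolding T_def by (intro Max_ge) auto
  have "cnt E c b = cnt E c (Max T)" using c c' up by (intro cnt_no_above) auto
  also have "\<dots> = Max T" using cnt_initial[OF assms(1)] c by blast
  finally have top: "cnt E c b = Max T" .
  show thesis
  proof (rule that[of c, unfolded top])
    show "\<forall>r c'. (r, c') \<in> E \<and> r \<le> b \<and> a \<le> c' \<longrightarrow> r \<le> Max T" using up by blast
  qed (use c c' in auto)
qed

text \<open>A cell entering the frozen rows falls into the highest gap, so either no cell has reached
  row t or below, or the rows between t and q are all occupied.\<close>

lemma filled_rows_frozen:
  assumes "kohnert_move\<^sup>*\<^sup>* D E" "c \<le> c'" "\<forall>s\<in>{1..q}. (s, c') \<in> D" "t \<le> q"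
  shows "(\<forall>s\<in>{1..q}. (s, c') \<in> E) \<and>
    ((\<forall>r\<le>t. (r, c) \<in> E \<longleftrightarrow> (r, c) \<in> D) \<or> (\<forall>r. t < r \<and> r \<le> q \<longrightarrow> (r, c) \<in> E))"
  using assms(1)
proof (induction rule: rtranclp_induct)
  case (step E F)
  then obtain r c0 r' where m: "cell_drop E r c0 r'" "F = insert (r', c0) (E - {(r, c0)})"
    unfolding kohnert_move_eq region_move_def by blast
  have full: "\<forall>s\<in>{1..q}. (s, c') \<in> E" using step.IH by blast
  \<comment> \<open>Each row up to \<open>q\<close> has a cell in column \<open>c'\<close>, so a
    cell of a column left of \<open>c'\<close> is not rightmost there, and in column
    \<open>c'\<close> itself there is no gap to fall into.\<close>
  have "q < r" if "c0 = c' \<or> c0 = c"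
  proof (rule ccontr)
    assume "\<not> q < r"
    then have "r \<in> {1..q}" "r' \<in> {1..q}" using m by (auto simp: cell_drop_def)
    then have "c' \<le> c0" "(r', c') \<in> E" using full m by (auto simp: cell_drop_def)
    then show False using that assms(2) m by (auto simp: cell_drop_def)
  qed
  then have q: "c0 = c' \<Longrightarrow> q < r" "c0 = c \<Longrightarrow> q < r" by auto
  have "\<forall>s\<in>{1..q}. (s, c') \<in> F" using full m q by auto
  moreover have "(\<forall>r\<le>t. (r, c) \<in> F \<longleftrightarrow> (r, c) \<in> D) \<or> (\<forall>r. t < r \<and> r \<le> q \<longrightarrow> (r, c) \<in> F)"
  proof (cases "c0 = c \<and> r' \<le> t")
    case True
    then have "\<forall>s. t < s \<and> s \<le> q \<longrightarrow> (s, c) \<in> F" using m q by (auto simp: cell_drop_def)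
    then show ?thesis by blast
  next
    case False
    then show ?thesis using step.IH m q assms(4) by fastforce
  qed
  ultimately show ?case by blast
qed (use assms in auto)

text \<open>The counting form of the statement that the i-th lowest cell of column c1, for i > f, never
  gets below the (i+d)-th lowest cell of column c2.\<close>

lemma shift_invariant:
  assumes "kohnert_move\<^sup>*\<^sup>* D E" "c1 < c2"
    "\<forall>t. cnt D c1 t \<le> f \<or> cnt D c1 t + d \<le> cnt D c2 t"
  shows "cnt E c1 t \<le> f \<or> cnt E c1 t + d \<le> cnt E c2 t"
  using assms(1)
proof (induction arbitrary: t rule: rtranclp_induct)
  case (step E F)
  then obtain r c r' where m: "cell_drop E r c r'" "F = insert (r', c) (E - {(r, c)})"
    unfolding kohnert_move_eq region_move_def by blast
  show ?case
  proof (cases "c = c1 \<and> r' \<le> t \<and> t < r")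
    case False
    then have "cnt F c1 t = cnt E c1 t" "cnt E c2 t \<le> cnt F c2 t" using m by (auto simp: cnt_move)
    then show ?thesis using step.IH[of t] by auto
  next
    case True
    then have F: "cnt F c1 t = cnt E c1 t + 1" "cnt F c2 t = cnt E c2 t"
      using m assms(2) by (auto simp: cnt_move)
    \<comment> \<open>Before the move, rows \<open>t + 1\<close> to \<open>r\<close> of column
      \<open>c1\<close> are all occupied, while \<open>(r, c2)\<close> is empty because the moving
      cell is rightmost. The induction hypothesis at \<open>r\<close> thus leaves room for one more
      cell at \<open>t\<close>.\<close>
    have "cnt E c1 r = cnt E c1 t + (r - t)"
    proof (rule cnt_filled)
      fix s assume "t < s" "s \<le> r"
      then show "(s, c1) \<in> E" using m True by (cases "s = r") (auto simp: cell_drop_def)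
    qed (use True in auto)
    moreover have "cnt E c2 r = cnt E c2 (r - 1)"
    proof (rule cnt_no_above)
      fix s assume "(s, c2) \<in> E" "s \<le> r"
      then show "s \<le> r - 1" using m True assms(2) by (cases "s = r") (auto simp: cell_drop_def)
    qed simp
    moreover have "cnt E c2 (r - 1) \<le> cnt E c2 t + (r - 1 - t)"
      using True by (intro cnt_le_add) auto
    ultimately show ?thesis using step.IH[of r] True F by linarith
  qed
qed (use assms(3) in auto)

section \<open>Matching columns of a northeast diagram\<close>

lemma cnt_pos:
  assumes "0 < cnt D c t" obtains r where "(r, c) \<in> D" "r \<le> t"
proof -
  have "{r. r \<le> t \<and> (r, c) \<in> D} \<noteq> {}" using assms unfolding cnt_def by (metis card.empty less_irrefl)
  then show thesis using that by blast
qed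

lemma row_bound:
  assumes "is_diagram D" obtains B where "\<forall>r c. (r, c) \<in> D \<longrightarrow> r \<le> B"
proof -
  have "finite (fst ` D)" using assms by (simp add: is_diagram_def)
  then obtain B where "\<forall>r\<in>fst ` D. r \<le> B" using finite_nat_set_iff_bounded_le by blast
  then show thesis using that by force
qed

lemma finite_column: "is_diagram D \<Longrightarrow> finite {r. (r, c) \<in> D \<and> P r}"
  by (rule finite_subset[of _ "fst ` D"]) (force simp: is_diagram_def)+

lemma northeastD:
  "northeast D \<Longrightarrow> (r1, c1) \<in> D \<Longrightarrow> (r2, c2) \<in> D \<Longrightarrow> r2 \<le> r1 \<Longrightarrow> c1 \<le> c2 \<Longrightarrow> (r1, c2) \<in> D"
  unfolding northeast_def by (metis max.absorb1 max.absorb2)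

text \<open>Here \<open>q\<close> is the highest row of a cell of column \<open>c\<close> below
  which some column from \<open>c\<close> on is filled, or 0 if there is none. The part of column
  \<open>c\<close> up to row \<open>q\<close> is frozen; its cells above satisfy condition (d) of
  the obstruction.\<close>

lemma frozen_height:
  assumes "is_diagram D" "northeast D"
  obtains q c' where "c \<le> c'" "\<forall>s\<in>{1..q}. (s, c') \<in> D"
    "\<forall>r c''. (r, c) \<in> D \<and> q < r \<and> c \<le> c'' \<longrightarrow> (\<exists>s. 1 \<le> s \<and> s < r \<and> (s, c'') \<notin> D)"
proof -
  define Q where "Q = {r. (r, c) \<in> D \<and> (\<exists>c'\<ge>c. \<forall>s. 1 \<le> s \<and> s < r \<longrightarrow> (s, c') \<in> D)}"
  have fin: "finite Q" unfolding Q_def by (rule finite_column[OF assms(1)])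
  show thesis
  proof (cases "Q = {}")
    case True
    then show thesis using that[of c 0] unfolding Q_def by auto
  next
    case False
    then have "Max Q \<in> Q" using fin by simp
    then obtain c' where c': "(Max Q, c) \<in> D" "c \<le> c'" "\<And>s. 1 \<le> s \<Longrightarrow> s < Max Q \<Longrightarrow> (s, c') \<in> D"
      unfolding Q_def by blast
    have up: "\<exists>s. 1 \<le> s \<and> s < r \<and> (s, c'') \<notin> D" if "(r, c) \<in> D" "Max Q < r" "c \<le> c''" for r c''
    proof (rule ccontr)
      assume "\<not> ?thesis"
      then have "r \<in> Q" using that unfolding Q_def by blast
      then show False using Max_ge[OF fin] that(2) by fastforce
    qed
    show thesis
    proof (cases "1 < Max Q")
      case True
      then have "(1, c') \<in> D" using c' by simp
      \<comment> \<open>The set \<open>Q\<close> only asks for filled rows strictly below; the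
        northeast condition for \<open>(Max Q, c)\<close> and \<open>(1, c')\<close> supplies row
        \<open>Max Q\<close>.\<close>
      then have "(Max Q, c') \<in> D" using northeastD[OF assms(2) c'(1)] c'(2) True by simp
      then have "\<forall>s\<in>{1..Max Q}. (s, c') \<in> D" using c'(3) by (auto simp: le_less)
      then show thesis using that[of c' "Max Q"] c'(2) up by blast
    next
      case False
      then have "\<forall>s\<in>{1..Max Q}. (s, c) \<in> D" using c'(1) by (auto simp: le_less)
      then show thesis using that[of c "Max Q"] up by blast
    qed
  qed
qed

text \<open>This provides the hypothesis of \<open>shift_invariant\<close> for the original diagram.
  From the lowest cell of \<open>c1\<close> above row \<open>q\<close> upwards, both columns occupy
  the same rows, so the surplus of column \<open>c2\<close> lies entirely below.\<close>

lemma shift_initial: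
  assumes "is_diagram D" "northeast D" "\<forall>r1 r2 r3. \<not> obstruction D r1 c1 r2 r3 c2"
    and bound: "\<forall>r c. (r, c) \<in> D \<longrightarrow> r \<le> B"
    and c2: "c1 < c2" "\<forall>c. c1 \<le> c \<and> c < c2 \<longrightarrow> cnt D c B < cnt D c2 B"
    and q: "\<forall>r c. (r, c1) \<in> D \<and> q < r \<and> c1 \<le> c \<longrightarrow> (\<exists>s. 1 \<le> s \<and> s < r \<and> (s, c) \<notin> D)"
  shows "cnt D c1 t \<le> cnt D c1 q \<or> cnt D c1 t + (cnt D c2 B - cnt D c1 B) \<le> cnt D c2 t"
proof (cases "cnt D c1 t \<le> cnt D c1 q")
  case False
  have B: "\<And>r c. (r, c) \<in> D \<Longrightarrow> r \<le> B" using bound by blast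
  have qt: "q < t" using False cnt_mono[of t q D c1] by (meson not_le)
  define S where "S = {r. (r, c1) \<in> D \<and> q < r}"
  define r0 where "r0 = Min S"
  define Y where "Y = {r. (r, c2) \<in> D \<and> r0 \<le> r}"
  have fin: "finite S" "finite Y" unfolding S_def Y_def by (rule finite_column[OF assms(1)])+
  obtain r where "r \<in> S" "r \<le> t"
  proof (rule ccontr)
    assume "\<not> thesis"
    then have "\<And>r. (r, c1) \<in> D \<Longrightarrow> r \<le> t \<Longrightarrow> r \<le> q" using that unfolding S_def by force
    then have "cnt D c1 t = cnt D c1 q" using qt by (intro cnt_no_above) auto
    then show False using False by simp
  qed
  then have r0: "r0 \<in> S" "r0 \<le> t" "\<And>r. r \<in> S \<Longrightarrow> r0 \<le> r"
    unfolding r0_def using fin by (auto intro: Min_le order_trans Min_in)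
  define below where "below y = {r \<in> S. r \<le> y}" for y
  have below: "Max (below y) \<in> S" "Max (below y) \<le> y" "\<And>r. r \<in> S \<Longrightarrow> r \<le> y \<Longrightarrow> r \<le> Max (below y)"
    if "y \<in> Y" for y
  proof -
    have "finite (below y)" "r0 \<in> below y" using that fin r0 unfolding below_def Y_def by auto
    then have "Max (below y) \<in> below y" using Max_in by blast
    then show "Max (below y) \<in> S" "Max (below y) \<le> y" unfolding below_def by auto
    show "r \<le> Max (below y)" if "r \<in> S" "r \<le> y" for r
      using that \<open>finite (below y)\<close> by (intro Max_ge) (auto simp: below_def)
  qed
  have noteq: "Max (below y) \<noteq> Max (below z)" if "y \<in> Y" "z \<in> Y" "y < z" for y z
  proof
    assume eq: "Max (below y) = Max (below z)"
    \<comment> \<open>If \<open>y < z\<close> have the same nearest cell of \<open>S\<close> at or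
      below them, column \<open>c1\<close> is empty above that cell up to row \<open>z\<close>,
      which is condition (e); condition (d) comes from the choice of \<open>q\<close>.\<close>
    have "obstruction D (Max (below y)) c1 y z c2"
      unfolding obstruction_def cnt_cwt[OF bound, symmetric]
    proof (intro conjI allI impI)
      show "(Max (below y), c1) \<in> D" using below(1)[OF that(1)] by (simp add: S_def)
      show "(y, c2) \<in> D" "(z, c2) \<in> D" using that by (auto simp: Y_def)
      show "\<exists>r\<ge>1. r < Max (below y) \<and> (r, c) \<notin> D" if "c1 \<le> c" for c
        using q that below(1)[OF \<open>y \<in> Y\<close>] by (auto simp: S_def)
      show "(r, c1) \<notin> D" if r: "Max (below y) < r \<and> r \<le> z" for r
      proof
        assume "(r, c1) \<in> D"
        then have "r \<in> S" using r below(1)[OF \<open>y \<in> Y\<close>] by (auto simp: S_def)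
        then show False using below(3)[OF \<open>z \<in> Y\<close>] r eq by fastforce
      qed
    qed (use c2 below(2)[OF that(1)] that in auto)
    then show False using assms(3) by blast
  qed
  have "inj_on (\<lambda>y. Max (below y)) Y"
    unfolding inj_on_def using noteq by (metis linorder_neqE_nat)
  then have card: "card Y \<le> card S"
    using fin below(1) by (intro card_inj_on_le[of "\<lambda>y. Max (below y)"]) auto
  have "0 < r0" using r0(1) by (simp add: S_def)
  \<comment> \<open>Otherwise all cells of \<open>c2\<close> lie in \<open>Y\<close>, making
    \<open>c2\<close> no heavier than \<open>c1\<close>. A cell of \<open>c2\<close> below
    \<open>r0\<close> lets the northeast condition copy the rows of \<open>S\<close> into
    \<open>c2\<close>.\<close>
  have "0 < cnt D c2 (r0 - 1)"
  proof (rule ccontr)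
    assume "\<not> ?thesis"
    moreover have "r0 \<le> B" using r0(1) B[of r0 c1] by (simp add: S_def)
    moreover have "{r. r0 - 1 < r \<and> r \<le> B \<and> (r, c2) \<in> D} = Y"
      using \<open>0 < r0\<close> unfolding Y_def by (auto dest: B)
    ultimately have "cnt D c2 B = card Y" using cnt_split[of "r0 - 1" B D c2] by simp
    also have "\<dots> \<le> card S" by (rule card)
    also have "\<dots> \<le> cnt D c1 B" unfolding cnt_def S_def by (intro card_mono) (auto dest: B)
    finally show False using c2 by (meson le_refl not_le)
  qed
  then obtain y where y: "(y, c2) \<in> D" "y \<le> r0 - 1" by (rule cnt_pos)
  have "S \<subseteq> Y"
  proof
    fix r assume r: "r \<in> S"
    then have "(r, c1) \<in> D" "r0 \<le> r" using r0(3) by (auto simp: S_def)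
    then show "r \<in> Y" using northeastD[OF assms(2) _ y(1), of r c1] y(2) c2(1) by (simp add: Y_def)
  qed
  then have "S = Y" using card fin by (simp add: card_seteq)
  have kk: "cnt D c1 B < cnt D c2 B" using c2 by simp
  define u where "u = max t B"
  have u: "cnt D c u = cnt D c B" for c unfolding u_def by (intro cnt_no_above) (auto dest: B)
  have "{r. t < r \<and> r \<le> u \<and> (r, c1) \<in> D} = {r. t < r \<and> r \<le> u \<and> (r, c2) \<in> D}"
  proof -
    have "(r, c1) \<in> D \<longleftrightarrow> (r, c2) \<in> D" if "t < r" for r
    proof -
      have "q < r" "r0 \<le> r" using that qt r0(2) by auto
      then have "r \<in> S \<longleftrightarrow> (r, c1) \<in> D" "r \<in> Y \<longleftrightarrow> (r, c2) \<in> D" by (auto simp: S_def Y_def)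
      then show ?thesis using \<open>S = Y\<close> by simp
    qed
    then show ?thesis by blast
  qed
  then show ?thesis
    using cnt_split[of t u D c1] cnt_split[of t u D c2] u kk by (simp add: u_def)
qed simp

section \<open>Uniqueness of the minimal diagram without an obstruction\<close>

text \<open>The formula depends on \<open>M\<close> only through \<open>A\<close>, where 0 stands
  for no cells right of \<open>c1\<close>. Truncation in \<open>cnt D c1 B + t - A\<close> is
  harmless under the maximum.\<close>

lemma stuck_column:
  assumes D: "is_diagram D" "northeast D" "\<forall>r1 c1 r2 r3 c2. \<not> obstruction D r1 c1 r2 r3 c2"
    and bound: "\<forall>r c. (r, c) \<in> D \<longrightarrow> r \<le> B"
    and M: "kohnert_move\<^sup>*\<^sup>* D M" "stuck UNIV M"
    and A: "\<forall>r c. (r, c) \<in> M \<and> c1 < c \<longrightarrow> r \<le> A" "A = 0 \<or> (\<exists>c>c1. (A, c) \<in> M)"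
  shows "cnt M c1 t = (if A \<le> cnt D c1 B then min t (cnt D c1 B)
    else if t \<le> A then max (cnt D c1 t) (cnt D c1 B + t - A) else cnt D c1 B)"
proof -
  define k where "k = cnt D c1 B"
  have dM: "is_diagram M" using is_diagram_moves M(1) D(1) by blast
  have MB: "\<And>r c. (r, c) \<in> M \<Longrightarrow> r \<le> B" and cntB: "\<And>c. cnt M c B = cnt D c B"
    using moves_rows_bounded[OF M(1) bound] by blast+
  \<comment> \<open>Above row \<open>A\<close> nothing lies to the right, so the blocking column is
    \<open>c1\<close> itself, which is therefore filled up to row \<open>r\<close>.\<close>
  have top: "r \<le> k" if r: "(r, c1) \<in> M" "A < r" for r
  proof -
    obtain c where c: "c1 \<le> c" "\<forall>s\<in>{1..r}. (s, c) \<in> M"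
      using M(2) r(1) unfolding stuck_def by blast
    then have "(r, c) \<in> M" using that(2) by simp
    then have "c = c1" using c(1) A(1) that(2) by fastforce
    then have "cnt M c1 r = r" using c(2) cnt_initial[OF dM] by blast
    moreover have "cnt M c1 r \<le> cnt M c1 B" using MB that(1) by (intro cnt_mono)
    ultimately show ?thesis using cntB k_def by simp
  qed
  show ?thesis
  proof (cases "A \<le> k")
    case True
    then have le: "r \<le> k" if "(r, c1) \<in> M" for r
      using top[OF that] by (cases "A < r") auto
    have "k \<le> B" using cnt_le[OF dM, of c1 B] cntB k_def by simp
    then have above: "cnt M c1 t = k" if "k \<le> t" for t
      using cnt_no_above[of k t c1 M] cnt_no_above[of k B c1 M] that le cntB k_def by simp
    have "cnt M c1 t = t" if "t \<le> k" for t
      using cnt_full[OF dM above[OF order_refl]] that by (intro cnt_initial[OF dM]) auto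
    then show ?thesis using above True by (auto simp: k_def min_def)
  next
    case False
    then have "k < A" by simp
    then obtain c0 where c0: "c1 < c0" "(A, c0) \<in> M" using A(2) by auto
    have "A \<le> B" using MB c0 by blast
    have le: "r \<le> A" if "c1 \<le> c" "(r, c) \<in> M" for r c
      using top[of r] A(1) that \<open>k < A\<close> by (cases "c = c1") force+
    have above: "cnt M c t = cnt D c B" if "A \<le> t" "c1 \<le> c" for t c
      using cnt_no_above[of A t c M] cnt_no_above[of A B c M] that le \<open>A \<le> B\<close> cntB by simp
    have leA: "cnt D c B \<le> A" if "c1 \<le> c" for c
      using above[OF order_refl that] cnt_le[OF dM, of c A] by simp
    show ?thesis
    proof (cases "t \<le> A")
      case True
      obtain c where c: "c0 \<le> c" "\<forall>s\<in>{1..A}. (s, c) \<in> M"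
        using M(2) c0(2) unfolding stuck_def by blast
      then have cA: "c1 < c \<and> cnt D c B = A"
        using c0(1) above[of A c] cnt_initial[OF dM, of A c] by auto
      \<comment> \<open>No column from \<open>c1\<close> on has more than \<open>A\<close> cells, so
        the first one right of \<open>c1\<close> with exactly \<open>A\<close> satisfies condition
        (c).\<close>
      define c2 where "c2 = (LEAST c. c1 < c \<and> cnt D c B = A)"
      have c2: "c1 < c2" "cnt D c2 B = A"
        unfolding c2_def using LeastI[of "\<lambda>c. c1 < c \<and> cnt D c B = A", OF cA] by blast+
      have "cnt D c B < cnt D c2 B" if "c1 \<le> c" "c < c2" for c
      proof (cases "c = c1")
        case False
        then have "cnt D c B \<noteq> A"
          using that not_less_Least[of c "\<lambda>c. c1 < c \<and> cnt D c B = A"] unfolding c2_def by auto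
        then show ?thesis using leA[OF that(1)] c2 by simp
      qed (use \<open>k < A\<close> c2 k_def in simp)
      then have less: "\<forall>c. c1 \<le> c \<and> c < c2 \<longrightarrow> cnt D c B < cnt D c2 B" by blast
      obtain q c' where q: "c1 \<le> c'" "\<forall>s\<in>{1..q}. (s, c') \<in> D"
        "\<forall>r c. (r, c1) \<in> D \<and> q < r \<and> c1 \<le> c \<longrightarrow> (\<exists>s. 1 \<le> s \<and> s < r \<and> (s, c) \<notin> D)"
        by (rule frozen_height[OF D(1,2), of c1])
      have shift: "cnt M c1 t \<le> cnt D c1 q \<or> cnt M c1 t + (A - k) \<le> t" for t
      proof -
        have "\<forall>r1 r2 r3. \<not> obstruction D r1 c1 r2 r3 c2" using D(3) by blast
        from shift_initial[OF D(1,2) this bound c2(1) less q(3)]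
        have "\<forall>t. cnt D c1 t \<le> cnt D c1 q \<or> cnt D c1 t + (A - k) \<le> cnt D c2 t"
          by (simp add: c2(2) k_def)
        then have "cnt M c1 t \<le> cnt D c1 q \<or> cnt M c1 t + (A - k) \<le> cnt M c2 t"
          by (rule shift_invariant[OF M(1) c2(1)])
        then show ?thesis using cnt_le[OF dM, of c2 t] by linarith
      qed
      \<comment> \<open>Above row \<open>q\<close> this is \<open>shift\<close>. Up to row
        \<open>q\<close>, either the column is unchanged up to row \<open>t\<close>, or it is filled
        from there to \<open>q\<close> and the bound at \<open>q\<close> carries down to
        \<open>t\<close>.\<close>
      have "cnt M c1 t \<le> cnt D c1 t \<or> cnt M c1 t + (A - k) \<le> t"
      proof (cases "t \<le> q")
        case False
        then show ?thesis using shift[of t] cnt_mono[of q t D c1] by linarith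
      next
        case tq: True
        consider "\<forall>r\<le>t. (r, c1) \<in> M \<longleftrightarrow> (r, c1) \<in> D" | "\<forall>r. t < r \<and> r \<le> q \<longrightarrow> (r, c1) \<in> M"
          using filled_rows_frozen[OF M(1) q(1,2) tq] by blast
        then show ?thesis
        proof cases
          case 1
          then have "{r. r \<le> t \<and> (r, c1) \<in> M} = {r. r \<le> t \<and> (r, c1) \<in> D}" by blast
          then show ?thesis by (simp add: cnt_def)
        next
          case 2
          then have "cnt M c1 q = cnt M c1 t + (q - t)" using tq by (intro cnt_filled) auto
          moreover have "cnt D c1 q \<le> cnt D c1 t + (q - t)" using tq by (rule cnt_le_add)
          ultimately show ?thesis using shift[of q] tq by linarith
        qed
      qed
      moreover have "cnt D c1 t \<le> cnt M c1 t" by (rule cnt_moves_mono[OF M(1)])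
      \<comment> \<open>All \<open>k\<close> cells lie in rows up to \<open>A\<close>, and at most
        \<open>A - t\<close> of them above row \<open>t\<close>.\<close>
      moreover have "k \<le> cnt M c1 t + (A - t)"
        using cnt_le_add[OF True, of M c1] above[of A c1] k_def by simp
      ultimately show ?thesis using True \<open>k < A\<close> unfolding k_def[symmetric] by auto
    next
      case False
      then show ?thesis using above[of t c1] \<open>k < A\<close> by (simp add: k_def)
    qed
  qed
qed

text \<open>In the rightmost column where the diagrams differ, \<open>stuck_column\<close> applies
  to both with the same \<open>A\<close> and forces equal counts.\<close>

lemma stuck_unique:
  assumes D: "is_diagram D" "northeast D" "\<forall>r1 c1 r2 r3 c2. \<not> obstruction D r1 c1 r2 r3 c2"
    and M: "kohnert_move\<^sup>*\<^sup>* D M" "stuck UNIV M"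
    and M': "kohnert_move\<^sup>*\<^sup>* D M'" "stuck UNIV M'"
  shows "M = M'"
proof (rule ccontr)
  assume "M \<noteq> M'"
  obtain B where B: "\<forall>r c. (r, c) \<in> D \<longrightarrow> r \<le> B" using row_bound[OF D(1)] by blast
  have d: "is_diagram M" "is_diagram M'" using is_diagram_moves M(1) M'(1) D(1) by blast+
  define X where "X = {c. \<exists>r. ((r, c) \<in> M) \<noteq> ((r, c) \<in> M')}"
  have "X \<subseteq> snd ` (M \<union> M')" unfolding X_def by force
  then have finX: "finite X" using d finite_subset unfolding is_diagram_def by blast
  have "X \<noteq> {}" using \<open>M \<noteq> M'\<close> unfolding X_def by auto
  define c1 where "c1 = Max X"
  have "c1 \<in> X" using finX \<open>X \<noteq> {}\<close> c1_def by simp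
  have eq: "(r, c) \<in> M \<longleftrightarrow> (r, c) \<in> M'" if "c1 < c" for r c
  proof (rule ccontr)
    assume "\<not> ?thesis"
    then have "c \<in> X" unfolding X_def by blast
    then show False using Max_ge[OF finX] that c1_def by fastforce
  qed
  define T where "T = {r. \<exists>c>c1. (r, c) \<in> M}"
  define A where "A = Max (insert 0 T)"
  have "T \<subseteq> fst ` M" unfolding T_def by force
  then have finT: "finite T" using d finite_subset unfolding is_diagram_def by blast
  then have "A \<in> insert 0 T" unfolding A_def by (intro Max_in) auto
  then have A2: "A = 0 \<or> (\<exists>c>c1. (A, c) \<in> M)" unfolding T_def by blast
  have "r \<le> A" if "(r, c) \<in> M" "c1 < c" for r c
    unfolding A_def using that finT by (intro Max_ge) (auto simp: T_def)
  then have A1: "\<forall>r c. (r, c) \<in> M \<and> c1 < c \<longrightarrow> r \<le> A" by blast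
  have A1': "\<forall>r c. (r, c) \<in> M' \<and> c1 < c \<longrightarrow> r \<le> A" and A2': "A = 0 \<or> (\<exists>c>c1. (A, c) \<in> M')"
    using A1 A2 eq by blast+
  have "cnt M c1 t = cnt M' c1 t" for t
    using stuck_column[OF D B M A1 A2] stuck_column[OF D B M' A1' A2'] by simp
  then have "(r, c1) \<in> M \<longleftrightarrow> (r, c1) \<in> M'" for r by (rule cnt_eq_column[OF d])
  then show False using \<open>c1 \<in> X\<close> unfolding X_def by blast
qed

section \<open>Two minimal diagrams from an obstruction\<close>

text \<open>The two diagrams are separated by the count of column \<open>c1\<close> up to a row
  \<open>t\<close>: below \<open>s\<close> in \<open>M1\<close>, at least \<open>s\<close> in
  \<open>M2\<close>.\<close>

lemma obstruction_two_stuck: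
  assumes D: "is_diagram D" "northeast D" and obs: "obstruction D r1 c1 r2 r3 c2"
  shows "\<exists>M M'. kohnert_move\<^sup>*\<^sup>* D M \<and> stuck UNIV M \<and> kohnert_move\<^sup>*\<^sup>* D M' \<and> stuck UNIV M' \<and> M \<noteq> M'"
proof -
  obtain B where bound: "\<forall>r c. (r, c) \<in> D \<longrightarrow> r \<le> B" using row_bound[OF D(1)] by blast
  then have B: "\<And>r c. (r, c) \<in> D \<Longrightarrow> r \<le> B" by blast
  have x: "(r1, c1) \<in> D" "(r2, c2) \<in> D" "(r3, c2) \<in> D" "r1 \<le> r2" "r2 < r3" "c1 < c2"
    and wt: "\<And>c. c1 \<le> c \<Longrightarrow> c < c2 \<Longrightarrow> cnt D c B < cnt D c2 B"
    and gap: "\<And>c. c1 \<le> c \<Longrightarrow> \<exists>r. 1 \<le> r \<and> r < r1 \<and> (r, c) \<notin> D"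
    and free: "\<And>r. r1 < r \<Longrightarrow> r \<le> r3 \<Longrightarrow> (r, c1) \<notin> D"
    using obs unfolding obstruction_def cnt_cwt[OF bound] by blast+
  define k where "k = cnt D c1 B"
  define s where "s = cnt D c1 r1"
  have "r1 \<le> B" using B x by blast

  \<comment> \<open>In \<open>E1\<close> column \<open>c1\<close> is still as in \<open>D\<close>,
    while some column \<open>p\<close> right of it is filled up to row \<open>A\<close>, which
    bounds the weight of every column right of \<open>c1\<close>.\<close>
  obtain E1 where E1: "(region_move (UNIV \<times> {Suc c1..}))\<^sup>*\<^sup>* D E1" "stuck (UNIV \<times> {Suc c1..}) E1"
    using reach_stuck[OF D(1)] by blast
  note E1' = region_move_kohnert[OF E1(1)]
  have dE1: "is_diagram E1" using is_diagram_moves[OF E1'] D(1) by blast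
  have E1B: "\<And>r c. (r, c) \<in> E1 \<Longrightarrow> r \<le> B" "\<And>c. cnt E1 c B = cnt D c B"
    using moves_rows_bounded[OF E1' bound] by blast+
  have "0 < cnt E1 c2 B" using wt[of c1] x(6) E1B(2) by simp
  then obtain y where "(y, c2) \<in> E1" "y \<le> B" by (rule cnt_pos)
  moreover have "stuck ({..B} \<times> {Suc c1..}) E1" by (rule stuck_subset[OF E1(2)]) auto
  ultimately obtain p where p: "Suc c1 \<le> p" "\<forall>s\<in>{1..cnt E1 p B}. (s, p) \<in> E1"
    "\<forall>r c'. (r, c') \<in> E1 \<and> r \<le> B \<and> Suc c1 \<le> c' \<longrightarrow> r \<le> cnt E1 p B"
    using stuck_top_row[OF dE1, of B "Suc c1" y c2] Suc_leI[OF x(6)] by metis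
  define A where "A = cnt E1 p B"
  have "A \<le> B" unfolding A_def by (rule cnt_le[OF dE1])
  have leA: "cnt D c B \<le> A" if "c1 < c" for c
  proof -
    have "r \<le> A" if "(r, c) \<in> E1" "r \<le> B" for r
      using p(3) that Suc_leI[OF \<open>c1 < c\<close>] unfolding A_def by blast
    then have "cnt E1 c B = cnt E1 c A" by (rule cnt_no_above[OF \<open>A \<le> B\<close>])
    then show ?thesis using cnt_le[OF dE1, of c A] E1B(2) by simp
  qed
  have "k < A" using wt[of c1] leA[of c2] x(6) k_def by simp

  \<comment> \<open>In \<open>E2\<close> the \<open>s\<close> cells of column \<open>c1\<close> from
    rows up to \<open>r1\<close> lie in rows up to \<open>t\<close>, the number of cells of a column
    \<open>p2\<close> in rows up to \<open>r1\<close>. Condition (d) gives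
    \<open>t < r1\<close>.\<close>
  obtain E2 where E2: "(region_move ({..r1} \<times> {c1..}))\<^sup>*\<^sup>* D E2" "stuck ({..r1} \<times> {c1..}) E2"
    using reach_stuck[OF D(1)] by blast
  note E2' = region_move_kohnert[OF E2(1)]
  have dE2: "is_diagram E2" using is_diagram_moves[OF E2'] D(1) by blast
  have cntE2: "\<And>c. cnt E2 c r1 = cnt D c r1" using cnt_moves_rows[OF E2(1)] by blast
  have "0 < s" unfolding s_def using cnt_less[of 0 r1 c1 D] gap[of c1] x(1) by force
  then have "0 < cnt E2 c1 r1" using cntE2 s_def by simp
  then obtain z where z: "(z, c1) \<in> E2" "z \<le> r1" by (rule cnt_pos)
  obtain p2 where p2: "c1 \<le> p2" "\<forall>s\<in>{1..cnt E2 p2 r1}. (s, p2) \<in> E2"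
    "\<forall>r c'. (r, c') \<in> E2 \<and> r \<le> r1 \<and> c1 \<le> c' \<longrightarrow> r \<le> cnt E2 p2 r1"
    by (rule stuck_top_row[OF dE2 E2(2) z order_refl])
  define t where "t = cnt D p2 r1"
  have t: "\<And>r. (r, c1) \<in> E2 \<Longrightarrow> r \<le> r1 \<Longrightarrow> r \<le> t" using p2(1,3) cntE2[of p2] t_def by (metis le_refl)
  have "t < r1"
  proof -
    obtain g where g: "1 \<le> g" "g < r1" "(g, p2) \<notin> D" using gap[OF p2(1)] by blast
    then have "t \<noteq> r1" using cnt_full[OF D(1), of p2 r1 g] t_def by auto
    then show ?thesis using cnt_le[OF D(1), of p2 r1] t_def by simp
  qed
  have "1 \<le> t" using t[OF z] z(1) dE2 unfolding is_diagram_def by auto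
  have sE2: "cnt E2 c1 t = s"
    using cnt_no_above[of t r1 c1 E2] t \<open>t < r1\<close> cntE2 s_def by simp
  define S where "S = {r. r1 < r \<and> r \<le> B \<and> (r, c1) \<in> D}"
  define P where "P = {r. r1 < r \<and> r \<le> B \<and> (r, p2) \<in> D}"
  have finP: "finite P" unfolding P_def by (rule finite_subset[of _ "{..B}"]) auto
  have k: "k = s + card S" and kp: "cnt D p2 B = t + card P"
    unfolding k_def s_def t_def S_def P_def using cnt_split[OF \<open>r1 \<le> B\<close>] by blast+
  \<comment> \<open>As \<open>k = s + card S\<close>, the second claim says
    \<open>t + card S < A\<close>. For \<open>p2 = c1\<close> this is \<open>k < A\<close>.
    Otherwise \<open>S \<subseteq> P\<close> by the northeast condition and
    \<open>t + card P \<le> A\<close>; strictness comes from (c) if \<open>p2 < c2\<close>, and else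
    from \<open>r3\<close>, which lies in \<open>P\<close> but by (e) not in
    \<open>S\<close>.\<close>
  have strict: "t \<le> A" "k + t < s + A"
  proof -
    show "t \<le> A"
      using leA[of p2] p2(1) kp \<open>k < A\<close> by (cases "p2 = c1") (auto simp: k_def)
    show "k + t < s + A"
    proof (cases "p2 = c1")
      case True
      then show ?thesis using \<open>k < A\<close> by (simp add: t_def s_def)
    next
      case False
      then have "c1 < p2" using p2(1) by simp
      have "0 < cnt D p2 r1" using \<open>1 \<le> t\<close> t_def by simp
      then obtain y where y: "(y, p2) \<in> D" "y \<le> r1" by (rule cnt_pos)
      have sub: "S \<subseteq> P"
        using northeastD[OF D(2) _ y(1), of _ c1] y(2) p2(1) unfolding S_def P_def by auto
      show ?thesis
      proof (cases "p2 < c2")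
        case True
        then have "cnt D p2 B < A" using wt[of p2] leA[of c2] x(6) \<open>c1 < p2\<close> by simp
        then show ?thesis using k kp card_mono[OF finP sub] by simp
      next
        case False
        then have "(r3, p2) \<in> D" using northeastD[OF D(2) x(3) y(1)] y(2) x by simp
        then have "r3 \<in> P" using B[of r3 p2] x by (simp add: P_def)
        moreover have "r3 \<notin> S" using free[of r3] x by (simp add: S_def)
        ultimately have "card S < card P" using sub finP by (intro psubset_card_mono) auto
        then show ?thesis using k kp leA[OF \<open>c1 < p2\<close>] by simp
      qed
    qed
  qed

  obtain M1 where M1: "kohnert_move\<^sup>*\<^sup>* E1 M1" "stuck UNIV M1" using reach_stuck_UNIV[OF dE1] by blast
  obtain M2 where M2: "kohnert_move\<^sup>*\<^sup>* E2 M2" "stuck UNIV M2" using reach_stuck_UNIV[OF dE2] by blast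
  have D1: "kohnert_move\<^sup>*\<^sup>* D M1" and D2: "kohnert_move\<^sup>*\<^sup>* D M2"
    using E1' E2' M1(1) M2(1) by (meson rtranclp_trans)+
  have "M1 \<noteq> M2"
  proof
    assume "M1 = M2"
    then have s: "s \<le> cnt M1 c1 t" using cnt_moves_mono[OF M2(1), of c1 t] sE2 by simp
    have full: "\<forall>s\<in>{1..A}. (s, p) \<in> E1" using p(2) by (simp add: A_def)
    have "c1 \<le> p" using p(1) by simp
    \<comment> \<open>Either rows up to \<open>t\<close> are as in \<open>D\<close>, where
      \<open>(r1, c1)\<close> lies above \<open>t\<close> and the count is below \<open>s\<close>,
      or rows \<open>t + 1\<close> to \<open>A\<close> are filled, which would take more than
      \<open>k\<close> cells.\<close>
    from filled_rows_frozen[OF M1(1) this full strict(1)]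
    consider "\<forall>r\<le>t. (r, c1) \<in> M1 \<longleftrightarrow> (r, c1) \<in> E1" | "\<forall>r. t < r \<and> r \<le> A \<longrightarrow> (r, c1) \<in> M1"
      by blast
    then show False
    proof cases
      case 1
      then have "{r. r \<le> t \<and> (r, c1) \<in> M1} = {r. r \<le> t \<and> (r, c1) \<in> D}"
        using columns_unmoved[OF E1(1), of c1] by auto
      then have "cnt M1 c1 t = cnt D c1 t" by (simp add: cnt_def)
      then show False using s s_def cnt_less[OF \<open>t < r1\<close> x(1)] by simp
    next
      case 2
      then have "cnt M1 c1 A = cnt M1 c1 t + (A - t)" using strict(1) by (intro cnt_filled) auto
      moreover have "cnt M1 c1 A \<le> k"
        using cnt_mono[OF \<open>A \<le> B\<close>, of M1 c1] moves_rows_bounded[OF D1 bound] k_def by simp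
      ultimately show False using s strict by linarith
    qed
  qed
  then show ?thesis using D1 D2 M1(2) M2(2) by blast
qed

section \<open>From blocked diagrams to the order\<close>

lemma minimal_element_iff_stuck:
  assumes "is_diagram D"
  shows "minimal_element (kohnert_poset D) M \<longleftrightarrow> kohnert_move\<^sup>*\<^sup>* D M \<and> stuck UNIV M"
proof
  assume *: "minimal_element (kohnert_poset D) M"
  then have M: "kohnert_move\<^sup>*\<^sup>* D M" by (simp add: minimal_element_def kohnert_poset_def)
  then have d: "is_diagram M" using is_diagram_moves assms by blast
  have "stuck UNIV M"
  proof (rule ccontr)
    assume "\<not> stuck UNIV M"
    then obtain E where E: "kohnert_move M E"
      using move_if_not_stuck[of M UNIV UNIV 0] d by (auto simp: is_diagram_def kohnert_move_eq)
    then have "sum fst E < sum fst M"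
      using sum_rows_move[of M UNIV E] d by (simp add: is_diagram_def kohnert_move_eq)
    then have "E \<noteq> M" by auto
    moreover have "kohnert_move\<^sup>*\<^sup>* D E" using M E by simp
    ultimately show False using * E unfolding minimal_element_def kohnert_poset_def lless_def by auto
  qed
  then show "kohnert_move\<^sup>*\<^sup>* D M \<and> stuck UNIV M" using M by simp
next
  assume *: "kohnert_move\<^sup>*\<^sup>* D M \<and> stuck UNIV M"
  then have "E = M" if "kohnert_move\<^sup>*\<^sup>* M E" for E
    using that stuck_no_move by (metis converse_rtranclpE)
  then show "minimal_element (kohnert_poset D) M"
    using * by (auto simp: minimal_element_def kohnert_poset_def lless_def)
qed

text \<open>Every element can be moved down to a blocked diagram, so a unique one lies below all
  elements; conversely, a blocked diagram above a least element equals it.\<close>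

lemma bounded_kohnert_poset_iff:
  assumes "is_diagram D"
  shows "bounded_poset (kohnert_poset D) \<longleftrightarrow> (\<exists>!M. kohnert_move\<^sup>*\<^sup>* D M \<and> stuck UNIV M)"
proof
  assume "bounded_poset (kohnert_poset D)"
  then obtain b where b: "kohnert_move\<^sup>*\<^sup>* D b" "\<And>E. kohnert_move\<^sup>*\<^sup>* D E \<Longrightarrow> kohnert_move\<^sup>*\<^sup>* E b"
    unfolding bounded_poset_def least_def kohnert_poset_def by auto
  have "E = b" if "kohnert_move\<^sup>*\<^sup>* D E" "stuck UNIV E" for E
    using b(2)[OF that(1)] stuck_no_move[OF that(2)] by (metis converse_rtranclpE)
  then show "\<exists>!M. kohnert_move\<^sup>*\<^sup>* D M \<and> stuck UNIV M" using reach_stuck_UNIV[OF assms] by metis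
next
  assume "\<exists>!M. kohnert_move\<^sup>*\<^sup>* D M \<and> stuck UNIV M"
  then obtain M where M: "kohnert_move\<^sup>*\<^sup>* D M" "\<And>E. kohnert_move\<^sup>*\<^sup>* D E \<Longrightarrow> stuck UNIV E \<Longrightarrow> E = M"
    by metis
  have least: "kohnert_move\<^sup>*\<^sup>* E M" if "kohnert_move\<^sup>*\<^sup>* D E" for E
  proof -
    have "is_diagram E" using is_diagram_moves that assms by blast
    then obtain F where "kohnert_move\<^sup>*\<^sup>* E F" "stuck UNIV F" using reach_stuck_UNIV by blast
    then show ?thesis using M(2) that by (metis rtranclp_trans)
  qed
  have antisym: "E = F"
    if "kohnert_move\<^sup>*\<^sup>* D E" "kohnert_move\<^sup>*\<^sup>* E F" "kohnert_move\<^sup>*\<^sup>* F E" for E F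
  proof -
    have "is_diagram E" "is_diagram F" using is_diagram_moves that(1,2) assms by blast+
    then show ?thesis using sum_rows_moves[OF that(2)] sum_rows_moves[OF that(3)] by auto
  qed
  have "partial_order (kohnert_poset D)"
  proof
    fix E F
    assume "E \<sqsubseteq>\<^bsub>kohnert_poset D\<^esub> F" "F \<sqsubseteq>\<^bsub>kohnert_poset D\<^esub> E"
      "E \<in> carrier (kohnert_poset D)" "F \<in> carrier (kohnert_poset D)"
    then show "E .=\<^bsub>kohnert_poset D\<^esub> F" using antisym[of E F] by (simp add: kohnert_poset_def)
  qed (auto simp: kohnert_poset_def)
  moreover have "least (kohnert_poset D) M (carrier (kohnert_poset D))"
    using M(1) least by (auto simp: least_def kohnert_poset_def)
  moreover have "greatest (kohnert_poset D) D (carrier (kohnert_poset D))"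
    by (auto simp: greatest_def kohnert_poset_def)
  ultimately show "bounded_poset (kohnert_poset D)" unfolding bounded_poset_def by blast
qed

theorem theorem1p5:
  fixes D0 :: diagram
  assumes "is_diagram D0" and "northeast D0"
  shows "(bounded_poset (kohnert_poset D0) \<longleftrightarrow> (\<exists>!m. minimal_element (kohnert_poset D0) m))
    \<and> (bounded_poset (kohnert_poset D0) \<longleftrightarrow>
        \<not> (\<exists>r1 c1 r2 c2 r3 c3.
              (r1, c1) \<in> D0 \<and> (r2, c2) \<in> D0 \<and> (r3, c3) \<in> D0
            \<and> (r1 \<le> r2 \<and> r2 < r3)
            \<and> (c1 < c2 \<and> c2 = c3)
            \<and> (\<forall>c. c1 \<le> c \<and> c < c2 \<longrightarrow> cwt D0 c < cwt D0 c2)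
            \<and> (\<forall>c. c1 \<le> c \<longrightarrow> (\<exists>r. 1 \<le> r \<and> r < r1 \<and> (r, c) \<notin> D0))
            \<and> (\<forall>r. r1 < r \<and> r \<le> r3 \<longrightarrow> (r, c1) \<notin> D0)))"
proof -
  have "(\<exists>!m. kohnert_move\<^sup>*\<^sup>* D0 m \<and> stuck UNIV m)
      \<longleftrightarrow> \<not> (\<exists>r1 c1 r2 c2 r3 c3. obstruction D0 r1 c1 r2 r3 c2 \<and> c2 = c3)"
    using reach_stuck_UNIV[OF assms(1)] stuck_unique[OF assms] obstruction_two_stuck[OF assms] by metis
  moreover have "obstruction D0 r1 c1 r2 r3 c2 \<and> c2 = c3 \<longleftrightarrow>
      (r1, c1) \<in> D0 \<and> (r2, c2) \<in> D0 \<and> (r3, c3) \<in> D0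
      \<and> (r1 \<le> r2 \<and> r2 < r3)
      \<and> (c1 < c2 \<and> c2 = c3)
      \<and> (\<forall>c. c1 \<le> c \<and> c < c2 \<longrightarrow> cwt D0 c < cwt D0 c2)
      \<and> (\<forall>c. c1 \<le> c \<longrightarrow> (\<exists>r. 1 \<le> r \<and> r < r1 \<and> (r, c) \<notin> D0))
      \<and> (\<forall>r. r1 < r \<and> r \<le> r3 \<longrightarrow> (r, c1) \<notin> D0)" for r1 c1 r2 c2 r3 c3
    unfolding obstruction_def by blast
  ultimately show ?thesis
    by (simp only: bounded_kohnert_poset_iff[OF assms(1)] minimal_element_iff_stuck[OF assms(1)] simp_thms)
qed

end
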